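(* Let $c\in\mathbb N$, let $G^w=\langle\mathcal V,\mathcal X,\mathcal Y,\rho^e,\rho^s,\varphi,w^s\rangle$ be a weighted game structure, let $c_0\in[0,c]$ and $s\in2^{\mathcal V}$. Let $G^*$ be the game structure constructed from $G^w$ and $c$ as described in the context. Then the system (resp. environment) wins from $s$ in $G^w$ w.r.t. $c$ for the initial credit $c_0$ if and only if the system (resp. environment) wins from the state $(s,c_0)$ in $G^*$.
   Context: Game structures. A GS is $G=\langle\mathcal V,\mathcal X,\mathcal Y,\rho^e,\rho^s,\varphi\rangle$: $\mathcal V$ finite set of Boolean variables, $\mathcal X\subseteq\mathcal V$ inputs (environment), $\mathcal Y=\mathcal V\setminus\mathcal X$ outputs (system); states $s\in2^{\mathcal V}$; $p(\cdot)$ maps assignments to primed copies; assignments to disjoint sets combine by union, written as tuples; $\rho^e$ over $\mathcal V\cup\mathcal X'$, $\rho^s$ over $\mathcal V\cup\mathcal V'$; $\varphi$ an $\omega$-regular condition. Each round from $s$: environment picks $s_{\mathcal X}$ with $(s,p(s_{\mathcal X}))\models\rho^e$, system picks $s_{\mathcal Y}$ with $(s,p(s_{\mathcal X}),p(s_{\mathcal Y}))\models\rho^s$; next state $(s_{\mathcal X},s_{\mathcal Y})$. Plays are infinite or finite ending in a deadlock for the environment (no valid input) or system (no valid output). A play wins for the system if it ends in an environment deadlock or is infinite and satisfies $\varphi$; otherwise it wins for the environment. A player wins from a state if it has a strategy from that state all of whose consistent plays win for it. WGS and energy. A WGS adds a partial weight function $w^s:2^{\mathcal V\cup\mathcal V'}\to\mathbb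 Z$ on $\rho^s$-transitions. For $c\in\mathbb N$ and $c_0\in[0,c]$ the energy level of $s_0\ldots s_k$ is $r_k$ with $r_0=c_0$, $r_i=\min(c,r_{i-1}+w^s(s_{i-1},p(s_i)))$. A play wins the $\varphi$-energy objective w.r.t. $c$ for $c_0$ if it wins for the system and all prefixes have non-negative energy level. The system (resp. environment) wins from $s$ w.r.t. $c$ for $c_0$ if it has a strategy from $s$ all of whose consistent plays win (resp. do not win) the $\varphi$-energy objective. The reduction $G^*$. $G^*=\langle\mathcal V^*,\mathcal X,\mathcal Y^*,\rho^e,\rho^{s*},\varphi\rangle$ where $\mathcal Y^*=\mathcal Y\cup yDom$, $yDom=\{y_0,\ldots,y_{\lfloor\log c\rfloor}\}$ are new system variables binary-encoding a value $y\in[0,c]$, $\mathcal V^*=\mathcal X\cup\mathcal Y^*$; states are pairs $(s,c_1)$ with $s\in2^{\mathcal V}$, $c_1\in[0,c]$; $\rho^e$ is unchanged; for all $s_1,s_2\in2^{\mathcal V}$, $c_1,c_2\in[0,c]$: $((s_1,c_1),p(s_2,c_2))\models\rho^{s*}$ iff $(s_1,p(s_2))\models\rho^s$ and $c_1+w^s(s_1,p(s_2))\ge c_2$; $\varphi$ is evaluated on the projection of plays to $\mathcal V$. *)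

theory Defs
  imports Main "HOL-Library.Discrete_Functions"
begin

text \<open>
  An assignment to a set of Boolean variables is represented by the set of variables it makes
  true. So \<open>Pow V\<close> is the set of assignments to \<open>V\<close>, and the union of assignments to disjoint sets
  of variables is the union of sets. An assertion over \<open>V\<close> and the primed copy of \<open>W\<close> is
  represented by the set of the pairs \<open>(s, t)\<close> such that \<open>s\<close> together with the primed copy of
  \<open>t\<close> satisfies it.
\<close>

record 'v game =
  vars :: "'v set"
  inputs :: "'v set"
  outputs :: "'v set"
  rho_e :: "('v set \<times> 'v set) set"
  rho_s :: "('v set \<times> 'v set) set"
  phi :: "(nat \<Rightarrow> 'v set) set"

record 'v weighted_game = "'v game" +
  weight :: "'v set \<times> 'v set \<Rightarrow> int option"

text \<open>Recognition by a nondeterministic Buechi automaton; its finitely many states may be taken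
  to be natural numbers.\<close>

definition omega_regular :: "'a set \<Rightarrow> (nat \<Rightarrow> 'a) set \<Rightarrow> bool" where
  "omega_regular \<Sigma> L \<longleftrightarrow>
    (\<exists>(Q :: nat set) I F \<delta>. finite Q \<and> I \<subseteq> Q \<and> F \<subseteq> Q \<and> \<delta> \<subseteq> Q \<times> \<Sigma> \<times> Q \<and>
      L = {w. \<exists>r. r 0 \<in> I \<and> (\<forall>i. (r i, w i, r (Suc i)) \<in> \<delta>) \<and> infinite {i. r i \<in> F}})"

definition game_structure :: "('v, 'm) game_scheme \<Rightarrow> bool" where
  "game_structure G \<longleftrightarrow>
    finite (vars G) \<and> inputs G \<subseteq> vars G \<and> outputs G = vars G - inputs G \<and>
    rho_e G \<subseteq> Pow (vars G) \<times> Pow (inputs G) \<and>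
    rho_s G \<subseteq> Pow (vars G) \<times> Pow (vars G) \<and>
    omega_regular (Pow (vars G)) (phi G)"

definition weighted_game_structure :: "('v, 'm) weighted_game_scheme \<Rightarrow> bool" where
  "weighted_game_structure G \<longleftrightarrow> game_structure G \<and> dom (weight G) = rho_s G"


subsection \<open>Plays\<close>

definition valid_inputs :: "('v, 'm) game_scheme \<Rightarrow> 'v set \<Rightarrow> 'v set set" where
  "valid_inputs G s = {x. x \<subseteq> inputs G \<and> (s, x) \<in> rho_e G}"

definition valid_outputs :: "('v, 'm) game_scheme \<Rightarrow> 'v set \<Rightarrow> 'v set \<Rightarrow> 'v set set" where
  "valid_outputs G s x = {y. y \<subseteq> outputs G \<and> (s, x \<union> y) \<in> rho_s G}"

definition successor :: "('v, 'm) game_scheme \<Rightarrow> 'v set \<Rightarrow> 'v set \<Rightarrow> bool" where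
  "successor G s t \<longleftrightarrow> (\<exists>x \<in> valid_inputs G s. \<exists>y \<in> valid_outputs G s x. t = x \<union> y)"

definition history_from :: "('v, 'm) game_scheme \<Rightarrow> 'v set \<Rightarrow> 'v set list \<Rightarrow> bool" where
  "history_from G s h \<longleftrightarrow> h \<noteq> [] \<and> hd h = s \<and> successively (successor G) h"

text \<open>\<open>Sys_Deadlock h x\<close>: after the states \<open>h\<close> the environment picks the input \<open>x\<close>, to which the
  system has no valid output.\<close>

datatype 'v play =
    Infinite "nat \<Rightarrow> 'v set"
  | Env_Deadlock "'v set list"
  | Sys_Deadlock "'v set list" "'v set"

fun play_from :: "('v, 'm) game_scheme \<Rightarrow> 'v set \<Rightarrow> 'v play \<Rightarrow> bool" where
  "play_from G s (Infinite \<pi>) \<longleftrightarrow> \<pi> 0 = s \<and> (\<forall>i. successor G (\<pi> i) (\<pi> (Suc i)))"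
| "play_from G s (Env_Deadlock h) \<longleftrightarrow> history_from G s h \<and> valid_inputs G (last h) = {}"
| "play_from G s (Sys_Deadlock h x) \<longleftrightarrow>
    history_from G s h \<and> x \<in> valid_inputs G (last h) \<and> valid_outputs G (last h) x = {}"

fun prefixes_of :: "'v play \<Rightarrow> 'v set list set" where
  "prefixes_of (Infinite \<pi>) = {map \<pi> [0..<n] | n. 0 < n}"
| "prefixes_of (Env_Deadlock h) = {take n h | n. 0 < n}"
| "prefixes_of (Sys_Deadlock h x) = {take n h | n. 0 < n}"

fun wins_for_system :: "('v, 'm) game_scheme \<Rightarrow> 'v play \<Rightarrow> bool" where
  "wins_for_system G (Infinite \<pi>) \<longleftrightarrow> \<pi> \<in> phi G"
| "wins_for_system G (Env_Deadlock h) \<longleftrightarrow> True"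
| "wins_for_system G (Sys_Deadlock h x) \<longleftrightarrow> False"


subsection \<open>Strategies\<close>

text \<open>Strategies may depend on the whole history. They are total functions; only their values at
  histories from \<open>s\<close> without a deadlock matter, and there they must be valid moves.\<close>

definition system_strategy ::
  "('v, 'm) game_scheme \<Rightarrow> 'v set \<Rightarrow> ('v set list \<Rightarrow> 'v set \<Rightarrow> 'v set) \<Rightarrow> bool" where
  "system_strategy G s f \<longleftrightarrow>
    (\<forall>h x. history_from G s h \<and> x \<in> valid_inputs G (last h) \<and> valid_outputs G (last h) x \<noteq> {} \<longrightarrow>
      f h x \<in> valid_outputs G (last h) x)"

definition environment_strategy ::
  "('v, 'm) game_scheme \<Rightarrow> 'v set \<Rightarrow> ('v set list \<Rightarrow> 'v set) \<Rightarrow> bool" where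
  "environment_strategy G s g \<longleftrightarrow>
    (\<forall>h. history_from G s h \<and> valid_inputs G (last h) \<noteq> {} \<longrightarrow> g h \<in> valid_inputs G (last h))"

definition system_consistent ::
  "('v, 'm) game_scheme \<Rightarrow> ('v set list \<Rightarrow> 'v set \<Rightarrow> 'v set) \<Rightarrow> 'v play \<Rightarrow> bool" where
  "system_consistent G f p \<longleftrightarrow>
    (\<forall>h t. h \<noteq> [] \<and> h @ [t] \<in> prefixes_of p \<longrightarrow> t \<inter> outputs G = f h (t \<inter> inputs G))"

definition environment_consistent ::
  "('v, 'm) game_scheme \<Rightarrow> ('v set list \<Rightarrow> 'v set) \<Rightarrow> 'v play \<Rightarrow> bool" where
  "environment_consistent G g p \<longleftrightarrow>
    (\<forall>h t. h \<noteq> [] \<and> h @ [t] \<in> prefixes_of p \<longrightarrow> t \<inter> inputs G = g h) \<and>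
    (\<forall>h x. p = Sys_Deadlock h x \<longrightarrow> x = g h)"

definition system_wins :: "('v, 'm) game_scheme \<Rightarrow> 'v set \<Rightarrow> bool" where
  "system_wins G s \<longleftrightarrow>
    (\<exists>f. system_strategy G s f \<and>
      (\<forall>p. play_from G s p \<and> system_consistent G f p \<longrightarrow> wins_for_system G p))"

definition environment_wins :: "('v, 'm) game_scheme \<Rightarrow> 'v set \<Rightarrow> bool" where
  "environment_wins G s \<longleftrightarrow>
    (\<exists>g. environment_strategy G s g \<and>
      (\<forall>p. play_from G s p \<and> environment_consistent G g p \<longrightarrow> \<not> wins_for_system G p))"


subsection \<open>Energy objectives\<close>

primrec energy ::
  "('v, 'm) weighted_game_scheme \<Rightarrow> nat \<Rightarrow> nat \<Rightarrow> (nat \<Rightarrow> 'v set) \<Rightarrow> nat \<Rightarrow> int" where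
  "energy G c c0 \<sigma> 0 = int c0"
| "energy G c c0 \<sigma> (Suc i) =
    min (int c) (energy G c c0 \<sigma> i + the (weight G (\<sigma> i, \<sigma> (Suc i))))"

definition energy_level ::
  "('v, 'm) weighted_game_scheme \<Rightarrow> nat \<Rightarrow> nat \<Rightarrow> 'v set list \<Rightarrow> int" where
  "energy_level G c c0 h = energy G c c0 (\<lambda>i. h ! i) (length h - 1)"

definition wins_energy_objective ::
  "('v, 'm) weighted_game_scheme \<Rightarrow> nat \<Rightarrow> nat \<Rightarrow> 'v play \<Rightarrow> bool" where
  "wins_energy_objective G c c0 p \<longleftrightarrow>
    wins_for_system G p \<and> (\<forall>h \<in> prefixes_of p. 0 \<le> energy_level G c c0 h)"

definition system_wins_energy ::
  "('v, 'm) weighted_game_scheme \<Rightarrow> nat \<Rightarrow> nat \<Rightarrow> 'v set \<Rightarrow> bool" where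
  "system_wins_energy G c c0 s \<longleftrightarrow>
    (\<exists>f. system_strategy G s f \<and>
      (\<forall>p. play_from G s p \<and> system_consistent G f p \<longrightarrow> wins_energy_objective G c c0 p))"

definition environment_wins_energy ::
  "('v, 'm) weighted_game_scheme \<Rightarrow> nat \<Rightarrow> nat \<Rightarrow> 'v set \<Rightarrow> bool" where
  "environment_wins_energy G c c0 s \<longleftrightarrow>
    (\<exists>g. environment_strategy G s g \<and>
      (\<forall>p. play_from G s p \<and> environment_consistent G g p \<longrightarrow> \<not> wins_energy_objective G c c0 p))"


subsection \<open>The reduction\<close>

text \<open>The original variables are embedded by \<open>Inl\<close>; \<open>Inr i\<close> is the new variable \<open>y_i\<close>. Hence the
  projection of a state \<open>t\<close> to the original variables is \<open>Inl -` t\<close>. For \<open>c = 0\<close>, where the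
  logarithm is undefined, \<open>floor_log 0 = 0\<close> gives the single variable \<open>y_0\<close>.\<close>

definition yDom :: "nat \<Rightarrow> ('v + nat) set" where
  "yDom c = Inr ` {0..floor_log c}"

definition star_state :: "'v set \<Rightarrow> nat \<Rightarrow> ('v + nat) set" where
  "star_state s c1 = Inl ` s \<union> Inr ` {i. bit c1 i}"

definition star_vars :: "('v, 'm) game_scheme \<Rightarrow> nat \<Rightarrow> ('v + nat) set" where
  "star_vars G c = Inl ` vars G \<union> yDom c"

text \<open>Assignments to \<open>yDom c\<close> that encode a value greater than \<open>c\<close> are not states of the
  construction; \<open>rho_s\<close> has no transitions from or to them.\<close>

definition star :: "('v, 'm) weighted_game_scheme \<Rightarrow> nat \<Rightarrow> ('v + nat) game" where
  "star G c = \<lparr>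
    vars = star_vars G c,
    inputs = Inl ` inputs G,
    outputs = Inl ` outputs G \<union> yDom c,
    rho_e = {(t, x). t \<subseteq> star_vars G c \<and> x \<subseteq> Inl ` inputs G \<and> (Inl -` t, Inl -` x) \<in> rho_e G},
    rho_s = {(star_state s1 c1, star_state s2 c2) | s1 s2 c1 c2.
      s1 \<subseteq> vars G \<and> s2 \<subseteq> vars G \<and> c1 \<le> c \<and> c2 \<le> c \<and>
      (s1, s2) \<in> rho_s G \<and> int c1 + the (weight G (s1, s2)) \<ge> int c2},
    phi = {\<pi>. (\<forall>i. \<pi> i \<subseteq> star_vars G c) \<and> (\<lambda>i. Inl -` \<pi> i) \<in> phi G}\<rparr>"

lemma bits_le_floor_log:
  fixes c c1 :: nat
  assumes "c1 \<le> c"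
  shows "{i. bit c1 i} \<subseteq> {0..floor_log c}"
proof
  fix i assume "i \<in> {i. bit c1 i}"
  then have "c1 div 2 ^ i \<noteq> 0" by (auto simp: bit_iff_odd intro: ccontr)
  then have "2 ^ i \<le> c" using assms by (metis div_less leI order.trans)
  then have "floor_log (2 ^ i) \<le> floor_log c" by (rule floor_log_mono[THEN monoD])
  then show "i \<in> {0..floor_log c}" by simp
qed

lemma star_state_vars: "s \<subseteq> vars G \<Longrightarrow> c1 \<le> c \<Longrightarrow> star_state s c1 \<subseteq> star_vars G c"
  using bits_le_floor_log[of c1 c] by (fastforce simp: star_state_def star_vars_def yDom_def)

lemma game_structure_star:
  assumes "weighted_game_structure G"
  shows "game_structure (star G c)"
proof -
  have G: "game_structure G" using assms by (simp add: weighted_game_structure_def)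
  then have "omega_regular (Pow (vars G)) (phi G)" by (simp add: game_structure_def)
  then obtain Q :: "nat set" and I F \<delta> where
    a: "finite Q" "I \<subseteq> Q" "F \<subseteq> Q" "\<delta> \<subseteq> Q \<times> Pow (vars G) \<times> Q" and
    L: "phi G = {w. \<exists>r. r 0 \<in> I \<and> (\<forall>i. (r i, w i, r (Suc i)) \<in> \<delta>) \<and> infinite {i. r i \<in> F}}"
    unfolding omega_regular_def by (elim exE conjE) (rule that)
  define \<delta>' where "\<delta>' = {(q, t, q'). t \<subseteq> star_vars G c \<and> (q, Inl -` t, q') \<in> \<delta>}"
  have "\<delta>' \<subseteq> Q \<times> Pow (star_vars G c) \<times> Q"
    using a(4) unfolding \<delta>'_def by blast
  moreover have "phi (star G c) =
      {w. \<exists>r. r 0 \<in> I \<and> (\<forall>i. (r i, w i, r (Suc i)) \<in> \<delta>') \<and> infinite {i. r i \<in> F}}"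
    unfolding \<delta>'_def star_def by (simp add: L) blast
  ultimately have reg: "omega_regular (Pow (star_vars G c)) (phi (star G c))"
    unfolding omega_regular_def using a(1-3) by (intro exI conjI)
  have "rho_s (star G c) \<subseteq> Pow (star_vars G c) \<times> Pow (star_vars G c)"
    by (auto simp: star_def dest: star_state_vars[THEN subsetD])
  moreover have "rho_e (star G c) \<subseteq> Pow (star_vars G c) \<times> Pow (inputs (star G c))"
    by (auto simp: star_def)
  moreover have "outputs (star G c) = vars (star G c) - inputs (star G c)"
    using G by (auto simp: star_def star_vars_def yDom_def game_structure_def)
  moreover have "inputs (star G c) \<subseteq> vars (star G c)" "finite (vars (star G c))"
    using G by (auto simp: star_def star_vars_def yDom_def game_structure_def)
  moreover have "vars (star G c) = star_vars G c" by (simp add: star_def)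
  ultimately show ?thesis
    using reg by (simp add: game_structure_def)
qed
end

theory Submission
  imports Defs
begin

text \<open>
  A play of the reduction is a play of the weighted game together with credits that never exceed
  the energy level. Hence energies stay non-negative when a play of the reduction is projected, and
  conversely the energy levels themselves, as long as they are non-negative, are admissible
  credits. Each of the four strategy translations follows one of these two maps between histories,
  except that a system strategy of the reduction dictates the credits itself. A deadlock of the
  system that only the reduction has is harmless: it is lost by the system, whose winning
  strategies therefore avoid it.
\<close>

section \<open>Winning in terms of consistent histories\<close>

text \<open>The relation \<open>M\<close> collects what is required of a move: agreement with a
  strategy of either player, possibly with a condition on the new history. Generating histories move
  by move makes each comparison of two games a rule induction, with deadlocks left to the
  characterisations of winning.\<close>

inductive outcome ::
  "('v, 'm) game_scheme \<Rightarrow> 'v set \<Rightarrow> ('v set list \<Rightarrow> 'v set \<Rightarrow> bool) \<Rightarrow> 'v set list \<Rightarrow> bool"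
  for G s M where
  init: "outcome G s M [s]"
| step: "outcome G s M h \<Longrightarrow> successor G (last h) t \<Longrightarrow> M h t \<Longrightarrow> outcome G s M (h @ [t])"

lemma outcome_not_Nil: "outcome G s M h \<Longrightarrow> h \<noteq> []"
  by (induction rule: outcome.induct) auto

lemma outcome_snocD:
  assumes "outcome G s M (h @ [t])" "h \<noteq> []"
  shows "outcome G s M h" "successor G (last h) t" "M h t"
  using assms by (auto elim: outcome.cases)

text \<open>The second assumption may use \<open>outcome G s M' h\<close>, which the induction has
  already established. Two strategies thus need to agree only at histories consistent with the
  target one.\<close>

lemma outcome_mono:
  assumes "outcome G s M h"
    and "\<And>h t. outcome G s M' h \<Longrightarrow> successor G (last h) t \<Longrightarrow> M h t \<Longrightarrow> M' h t"
  shows "outcome G s M' h"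
  using assms(1) by induction (auto intro: outcome.intros assms(2))

lemma outcome_take: "outcome G s M h \<Longrightarrow> 0 < n \<Longrightarrow> outcome G s M (take n h)"
proof (induction rule: outcome.induct)
  case (step h t)
  then show ?case
    by (cases "n \<le> length h") (auto intro: outcome.step)
qed (auto intro: outcome.init)

lemma outcome_history: "outcome G s M h \<Longrightarrow> history_from G s h"
  by (induction rule: outcome.induct) (auto simp: history_from_def successively_append_iff)

lemma history_outcome:
  assumes "history_from G s h" "\<And>h' t n. h' \<noteq> [] \<Longrightarrow> h' @ [t] = take n h \<Longrightarrow> M h' t"
  shows "outcome G s M h"
  using assms
proof (induction h rule: rev_induct)
  case (snoc t h)
  show ?case
  proof (cases "h = []")
    case True
    with snoc.prems show ?thesis by (auto simp: history_from_def intro: outcome.init)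
  next
    case False
    have "history_from G s h" "successor G (last h) t"
      using snoc.prems(1) False by (auto simp: history_from_def successively_append_iff)
    \<comment> \<open>The assumption concerns prefixes of \<open>h @ [t]\<close>, and taking
      \<open>n\<close> states of it may go beyond \<open>h\<close>; hence \<open>n\<close> is capped
      at \<open>length h\<close>.\<close>
    moreover have "M h' t'" if "h' \<noteq> []" "h' @ [t'] = take n h" for h' t' n
      using that snoc.prems(2)[of h' t' "min n (length h)"] by (simp add: min_def split: if_splits)
    moreover have "M h t" using snoc.prems(2)[of h t "Suc (length h)"] False by simp
    ultimately show ?thesis using snoc.IH by (auto intro: outcome.step)
  qed
qed (simp add: history_from_def)

text \<open>Consistency of an infinite play is a property of its finite prefixes, so simulations of
  histories carry over to infinite plays. The lengths are \<open>Suc n\<close> because histories are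
  non-empty.\<close>

lemma outcome_map_upt:
  "(\<forall>n. outcome G s M (map \<pi> [0..<Suc n])) \<longleftrightarrow>
    \<pi> 0 = s \<and> (\<forall>i. successor G (\<pi> i) (\<pi> (Suc i)) \<and> M (map \<pi> [0..<Suc i]) (\<pi> (Suc i)))"
  (is "?L \<longleftrightarrow> ?R")
proof
  assume L: ?L
  have "\<pi> 0 = s"
    using outcome_history[OF L[rule_format, of 0]] by (simp add: history_from_def)
  moreover have "successor G (\<pi> i) (\<pi> (Suc i)) \<and> M (map \<pi> [0..<Suc i]) (\<pi> (Suc i))" for i
    using L[rule_format, of "Suc i"] outcome_snocD[of G s M "map \<pi> [0..<Suc i]" "\<pi> (Suc i)"]
    by simp
  ultimately show ?R by blast
next
  assume R: ?R
  show ?L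
  proof
    fix n show "outcome G s M (map \<pi> [0..<Suc n])"
    proof (induction n)
      case (Suc n)
      then show ?case
        using R outcome.step[of G s M "map \<pi> [0..<Suc n]" "\<pi> (Suc n)"] by simp
    qed (use R outcome.init[of G s M] in simp)
  qed
qed

lemma prefixes_of_Infinite: "prefixes_of (Infinite \<pi>) = {map \<pi> [0..<Suc n] | n. True}"
  by (auto simp del: upt_Suc simp: gr0_conv_Suc)

text \<open>The hypothesis on \<open>M\<close> has the shape of the definitions of consistency, so
  this passes from consistent plays to outcomes; \<open>outcome_prefix_move\<close> and
  \<open>outcome_Infinite_move\<close> pass back.\<close>

lemma play_prefix_outcome:
  assumes "play_from G s p" "\<And>h t. h \<noteq> [] \<Longrightarrow> h @ [t] \<in> prefixes_of p \<Longrightarrow> M h t"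
    and "h \<in> prefixes_of p"
  shows "outcome G s M h"
proof (cases p)
  case (Infinite \<pi>)
  have "M (map \<pi> [0..<Suc i]) (\<pi> (Suc i))" for i
  proof (rule assms(2))
    have "map \<pi> [0..<Suc i] @ [\<pi> (Suc i)] = map \<pi> [0..<Suc (Suc i)]" by simp
    then show "map \<pi> [0..<Suc i] @ [\<pi> (Suc i)] \<in> prefixes_of p"
      unfolding Infinite prefixes_of_Infinite by blast
  qed simp
  then have "\<forall>n. outcome G s M (map \<pi> [0..<Suc n])"
    using assms(1) Infinite by (simp add: outcome_map_upt del: upt_Suc)
  then show ?thesis using assms(3) unfolding Infinite prefixes_of_Infinite by auto
next
  case (Env_Deadlock k)
  have "outcome G s M k"
  proof (rule history_outcome)
    fix h' t n assume "h' \<noteq> []" "h' @ [t] = take n k"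
    moreover from this have "0 < n" by (cases n) auto
    ultimately show "M h' t" using assms(2)[of h' t] Env_Deadlock by auto
  qed (use assms(1) Env_Deadlock in simp)
  then show ?thesis using assms(3) Env_Deadlock by (auto intro: outcome_take)
next
  case (Sys_Deadlock k x)
  have "outcome G s M k"
  proof (rule history_outcome)
    fix h' t n assume "h' \<noteq> []" "h' @ [t] = take n k"
    moreover from this have "0 < n" by (cases n) auto
    ultimately show "M h' t" using assms(2)[of h' t] Sys_Deadlock by auto
  qed (use assms(1) Sys_Deadlock in simp)
  then show ?thesis using assms(3) Sys_Deadlock by (auto intro: outcome_take)
qed

lemma outcome_prefix_move:
  assumes "outcome G s M k" "h \<noteq> []" "h @ [t] \<in> {take n k | n. 0 < n}"
  shows "M h t"
proof -
  obtain n where "0 < n" "h @ [t] = take n k" using assms(3) by blast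
  then have "outcome G s M (h @ [t])" using outcome_take[OF assms(1)] by simp
  then show ?thesis using assms(2) by (rule outcome_snocD)
qed

lemma outcome_Infinite_move:
  assumes "\<forall>n. outcome G s M (map \<pi> [0..<Suc n])" "h \<noteq> []" "h @ [t] \<in> prefixes_of (Infinite \<pi>)"
  shows "M h t"
proof -
  have "outcome G s M (h @ [t])" using assms(1,3) unfolding prefixes_of_Infinite by auto
  then show ?thesis using assms(2) by (rule outcome_snocD)
qed

lemma outcome_Infinite_play:
  "\<forall>n. outcome G s M (map \<pi> [0..<Suc n]) \<Longrightarrow> play_from G s (Infinite \<pi>)"
  by (simp add: outcome_map_upt del: upt_Suc)

section \<open>Winning strategies of the system\<close>

abbreviation system_moves ::
  "('v, 'm) game_scheme \<Rightarrow> ('v set list \<Rightarrow> 'v set \<Rightarrow> 'v set) \<Rightarrow> 'v set list \<Rightarrow> 'v set \<Rightarrow> bool" where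
  "system_moves G f h t \<equiv> t \<inter> outputs G = f h (t \<inter> inputs G)"

lemma valid_moves_Int:
  assumes "game_structure G" "x \<in> valid_inputs G s" "y \<in> valid_outputs G s x"
  shows "(x \<union> y) \<inter> inputs G = x" "(x \<union> y) \<inter> outputs G = y"
  using assms by (auto simp: game_structure_def valid_inputs_def valid_outputs_def)

lemma successor_Int:
  assumes "game_structure G" "successor G s t"
  shows "t \<inter> inputs G \<in> valid_inputs G s" "t \<inter> outputs G \<in> valid_outputs G s (t \<inter> inputs G)"
    "t = (t \<inter> inputs G) \<union> (t \<inter> outputs G)"
  using assms valid_moves_Int[OF assms(1)] unfolding successor_def by fastforce+

text \<open>Objectives constrain prefixes of complete plays, whereas the characterisation below
  speaks of all consistent histories. Following \<open>f\<close> from \<open>h\<close> either can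
  meet a deadlock or can always go on, and both give a play through \<open>h\<close>.\<close>

lemma system_outcome_extends:
  assumes G: "game_structure G" and f: "system_strategy G s f"
    and h: "outcome G s (system_moves G f) h"
  obtains p where "play_from G s p" "system_consistent G f p" "h \<in> prefixes_of p"
proof -
  let ?O = "outcome G s (system_moves G f)"
  let ?ext = "\<lambda>k. ?O k \<and> take (length h) k = h"
  show ?thesis
  \<comment> \<open>Any deadlock reachable along consistent extensions of \<open>h\<close> will do;
    \<open>take (length h) k = h\<close> says that \<open>h\<close> is a prefix of
    \<open>k\<close>.\<close>
  proof (cases "\<exists>k p. ?ext k \<and> play_from G s p \<and> (p = Env_Deadlock k \<or> (\<exists>x. p = Sys_Deadlock k x))")
    case True
    then obtain k p where k: "?ext k" "play_from G s p"
      and p: "p = Env_Deadlock k \<or> (\<exists>x. p = Sys_Deadlock k x)" by blast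
    have pre: "prefixes_of p = {take n k | n. 0 < n}" using p by auto
    have "h \<in> prefixes_of p"
      unfolding pre mem_Collect_eq
      using conjunct2[OF k(1), symmetric] outcome_not_Nil[OF h] length_greater_0_conv by blast
    moreover have "system_consistent G f p"
      unfolding system_consistent_def pre
      using outcome_prefix_move[OF conjunct1[OF k(1)]] by blast
    ultimately show ?thesis using k(2) that by blast
  next
    case stuck: False
    have "\<exists>k'. ?ext k' \<and> (\<exists>t. k' = k @ [t])" if k: "?ext k" for k
    proof -
      have hist: "history_from G s k" using k outcome_history by blast
      have live: "\<not> play_from G s (Env_Deadlock k)" "\<not> play_from G s (Sys_Deadlock k x)" for x
        using stuck k by blast+
      obtain x where x: "x \<in> valid_inputs G (last k)"
        using live(1) hist by auto
      then have "valid_outputs G (last k) x \<noteq> {}"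
        using live(2)[of x] hist by simp
      then have y: "f k x \<in> valid_outputs G (last k) x"
        using f hist x by (auto simp: system_strategy_def)
      have "successor G (last k) (x \<union> f k x)" using x y unfolding successor_def by blast
      then have "?O (k @ [x \<union> f k x])"
        by (rule outcome.step[OF conjunct1[OF k]]) (use valid_moves_Int[OF G x y] in simp)
      moreover have "length h \<le> length k"
        using arg_cong[OF conjunct2[OF k], of length] unfolding length_take by linarith
      then have "take (length h) (k @ [x \<union> f k x]) = h" using conjunct2[OF k] by simp
      ultimately show ?thesis by blast
    qed
    then have "\<forall>k. \<exists>k'. ?ext k \<longrightarrow> ?ext k' \<and> (\<exists>t. k' = k @ [t])" by blast
    from choice[OF this] obtain next_of where next_of:
      "\<And>k. ?ext k \<Longrightarrow> ?ext (next_of k) \<and> (\<exists>t. next_of k = k @ [t])" by blast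
    define K where "K n = (next_of ^^ n) h" for n
    have K0: "K 0 = h" by (simp add: K_def)
    have K_ext: "?ext (K n)" for n
    proof (induction n)
      case (Suc n)
      show ?case using next_of[OF Suc] by (simp add: K_def)
    qed (simp add: K0 h)
    have K_Suc: "\<exists>t. K (Suc n) = K n @ [t]" for n
      using next_of[OF K_ext[of n]] by (simp add: K_def)
    have len: "length (K n) = length h + n" for n
    proof (induction n)
      case (Suc n)
      then show ?case using K_Suc[of n] by auto
    qed (simp add: K0)
    \<comment> \<open>The limit of the chain of extensions. As \<open>h\<close> is non-empty,
      \<open>K i\<close> has more than \<open>i\<close> entries, and later members of the chain only
      append to it.\<close>
    define \<pi> where "\<pi> i = K i ! i" for i
    have nth: "K n ! i = K m ! i" if "i < length (K m)" "m \<le> n" for i m n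
      using that(2)
    proof (induction rule: dec_induct)
      case (step n)
      then show ?case using K_Suc[of n] that(1) len by (auto simp: nth_append)
    qed simp
    have pos: "0 < length h" using outcome_not_Nil[OF h] by simp
    have \<pi>: "map \<pi> [0..<n] = take n (K n)" for n
    proof (rule nth_equalityI)
      fix i assume "i < length (map \<pi> [0..<n])"
      then show "map \<pi> [0..<n] ! i = take n (K n) ! i"
        using nth[of i i n] pos by (simp add: \<pi>_def len)
    qed (simp add: len)
    have "\<forall>n. ?O (map \<pi> [0..<Suc n])"
      unfolding \<pi> using outcome_take[OF conjunct1[OF K_ext]] by blast
    then have "play_from G s (Infinite \<pi>)" "system_consistent G f (Infinite \<pi>)"
      unfolding system_consistent_def
      using outcome_Infinite_play outcome_Infinite_move by blast+
    moreover have "h = map \<pi> [0..<length h]"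
      using K_ext[of "length h"] by (simp add: \<pi>)
    then have "h \<in> prefixes_of (Infinite \<pi>)" using pos by auto
    ultimately show ?thesis by (rule that)
  qed
qed

text \<open>\<open>P\<close> stands for any demand on prefixes. The system loses its own deadlocks,
  hence \<open>f\<close> must have a valid answer to each valid input at consistent histories. On
  the right, \<open>f\<close> is constrained only at those histories, which is what a simulation can
  deliver.\<close>

lemma system_wins_iff_outcomes:
  assumes G: "game_structure G"
  shows "(\<exists>f. system_strategy G s f \<and> (\<forall>p. play_from G s p \<and> system_consistent G f p \<longrightarrow>
        wins_for_system G p \<and> (\<forall>h \<in> prefixes_of p. P h))) \<longleftrightarrow>
    (\<exists>f. (\<forall>h. outcome G s (system_moves G f) h \<longrightarrow>
          P h \<and> (\<forall>x \<in> valid_inputs G (last h). f h x \<in> valid_outputs G (last h) x)) \<and>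
      (\<forall>\<pi>. (\<forall>n. outcome G s (system_moves G f) (map \<pi> [0..<Suc n])) \<longrightarrow> \<pi> \<in> phi G))"
    (is "?L \<longleftrightarrow> ?R")
proof
  assume ?L
  then obtain f where f: "system_strategy G s f"
    and win: "\<And>p. play_from G s p \<Longrightarrow> system_consistent G f p \<Longrightarrow>
      wins_for_system G p \<and> (\<forall>h \<in> prefixes_of p. P h)" by blast
  have "P h" if "outcome G s (system_moves G f) h" for h
    using system_outcome_extends[OF G f that] win by metis
  moreover have "f h x \<in> valid_outputs G (last h) x"
    if h: "outcome G s (system_moves G f) h" and x: "x \<in> valid_inputs G (last h)" for h x
  proof (cases "valid_outputs G (last h) x = {}")
    case True
    \<comment> \<open>The play that stops here would be consistent with \<open>f\<close> and lost by
      the system.\<close>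
    then have "play_from G s (Sys_Deadlock h x)" using outcome_history[OF h] x by simp
    moreover have "system_consistent G f (Sys_Deadlock h x)"
      using outcome_prefix_move[OF h] by (auto simp: system_consistent_def)
    ultimately show ?thesis using win by fastforce
  next
    case False
    then show ?thesis using f outcome_history[OF h] x by (auto simp: system_strategy_def)
  qed
  moreover have "\<pi> \<in> phi G" if "\<forall>n. outcome G s (system_moves G f) (map \<pi> [0..<Suc n])" for \<pi>
  proof -
    have "play_from G s (Infinite \<pi>)" "system_consistent G f (Infinite \<pi>)"
      using outcome_Infinite_play[OF that] outcome_Infinite_move[OF that]
      unfolding system_consistent_def by blast+
    then show ?thesis using win by fastforce
  qed
  ultimately show ?R by blast
next
  assume ?R
  then obtain f where f: "\<And>h. outcome G s (system_moves G f) h \<Longrightarrow>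
          P h \<and> (\<forall>x \<in> valid_inputs G (last h). f h x \<in> valid_outputs G (last h) x)"
    and inf: "\<And>\<pi>. \<forall>n. outcome G s (system_moves G f) (map \<pi> [0..<Suc n]) \<Longrightarrow> \<pi> \<in> phi G"
    by blast
  \<comment> \<open>Away from outcomes \<open>f\<close> may propose invalid moves, whereas a
    strategy must be valid at all histories. Such proposals are replaced by arbitrary valid
    outputs.\<close>
  define f' where "f' h x = (if f h x \<in> valid_outputs G (last h) x then f h x
    else SOME y. y \<in> valid_outputs G (last h) x)" for h x
  have "system_strategy G s f'"
    by (auto simp: system_strategy_def f'_def intro: someI)
  moreover have "wins_for_system G p \<and> (\<forall>h \<in> prefixes_of p. P h)"
    if p: "play_from G s p" "system_consistent G f' p" for p
  proof -
    have "outcome G s (system_moves G f') h" if "h \<in> prefixes_of p" for h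
      using play_prefix_outcome[OF p(1) _ that] p(2) by (auto simp: system_consistent_def)
    \<comment> \<open>At an outcome of \<open>f\<close> its replies to valid inputs are valid, so
      \<open>f'\<close> agrees with it there and never leaves these histories.\<close>
    moreover have "outcome G s (system_moves G f) h" if "outcome G s (system_moves G f') h" for h
      using that by (rule outcome_mono) (use f successor_Int(1)[OF G] in \<open>auto simp: f'_def\<close>)
    ultimately have out: "outcome G s (system_moves G f) h" if "h \<in> prefixes_of p" for h
      using that by blast
    have "wins_for_system G p"
    proof (cases p)
      case (Infinite \<pi>)
      have "outcome G s (system_moves G f) (map \<pi> [0..<Suc n])" for n
        by (rule out) (unfold Infinite prefixes_of_Infinite, blast)
      then show ?thesis using inf[of \<pi>] Infinite by simp
    next
      case (Sys_Deadlock k x)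
      have "k \<in> prefixes_of p"
        using p(1) Sys_Deadlock by (auto simp: history_from_def intro!: exI[of _ "length k"])
      then show ?thesis using f out p(1) Sys_Deadlock by fastforce
    qed simp
    then show ?thesis using out f by blast
  qed
  ultimately show ?L by blast
qed

section \<open>Winning strategies of the environment\<close>

abbreviation environment_moves :: "('v, 'm) game_scheme \<Rightarrow> ('v set list \<Rightarrow> bool) \<Rightarrow>
    ('v set list \<Rightarrow> 'v set) \<Rightarrow> 'v set list \<Rightarrow> 'v set \<Rightarrow> bool" where
  "environment_moves G P g h t \<equiv> t \<inter> inputs G = g h \<and> P (h @ [t])"

lemma outcome_environment_safe:
  "outcome G s (environment_moves G P g) h \<Longrightarrow> P [s] \<Longrightarrow> P h"
  by (induction rule: outcome.induct) auto

text \<open>Once \<open>P\<close> fails the environment has won, so only histories on which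
  \<open>P\<close> still holds are followed; \<open>P [s]\<close> covers the start, to which no move
  leads. On these histories a deadlock of the environment would be lost, hence \<open>g\<close> must
  have a valid input, while a deadlock of the system is won and imposes nothing.\<close>

lemma environment_wins_iff_outcomes:
  assumes G: "game_structure G" and Ps: "P [s]"
  shows "(\<exists>g. environment_strategy G s g \<and> (\<forall>p. play_from G s p \<and> environment_consistent G g p \<longrightarrow>
        \<not> (wins_for_system G p \<and> (\<forall>h \<in> prefixes_of p. P h)))) \<longleftrightarrow>
    (\<exists>g. (\<forall>h. outcome G s (environment_moves G P g) h \<longrightarrow> g h \<in> valid_inputs G (last h)) \<and>
      (\<forall>\<pi>. (\<forall>n. outcome G s (environment_moves G P g) (map \<pi> [0..<Suc n])) \<longrightarrow> \<pi> \<notin> phi G))"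
    (is "?L \<longleftrightarrow> ?R")
proof
  assume ?L
  then obtain g where g: "environment_strategy G s g"
    and win: "\<And>p. play_from G s p \<Longrightarrow> environment_consistent G g p \<Longrightarrow>
      \<not> (wins_for_system G p \<and> (\<forall>h \<in> prefixes_of p. P h))" by blast
  have "g h \<in> valid_inputs G (last h)" if h: "outcome G s (environment_moves G P g) h" for h
  proof (cases "valid_inputs G (last h) = {}")
    case True
    \<comment> \<open>This finite play is consistent with \<open>g\<close> and keeps
      \<open>P\<close>, so the system would win it, against the choice of \<open>g\<close>.\<close>
    then have "play_from G s (Env_Deadlock h)" using outcome_history[OF h] by simp
    moreover have "environment_consistent G g (Env_Deadlock h)"
      using outcome_prefix_move[OF h] by (auto simp: environment_consistent_def)
    moreover have "\<forall>h' \<in> prefixes_of (Env_Deadlock h). P h'"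
      using outcome_environment_safe[where P = P, OF outcome_take[OF h] Ps] by auto
    ultimately show ?thesis using win[of "Env_Deadlock h"] wins_for_system.simps(2) by blast
  next
    case False
    then show ?thesis using g outcome_history[OF h] by (auto simp: environment_strategy_def)
  qed
  moreover have "\<pi> \<notin> phi G"
    if \<pi>: "\<forall>n. outcome G s (environment_moves G P g) (map \<pi> [0..<Suc n])" for \<pi>
  proof -
    have "play_from G s (Infinite \<pi>)" "environment_consistent G g (Infinite \<pi>)"
      using outcome_Infinite_play[OF that] outcome_Infinite_move[OF that]
      unfolding environment_consistent_def by blast+
    moreover have "\<forall>h' \<in> prefixes_of (Infinite \<pi>). P h'"
      using \<pi> outcome_environment_safe[where P = P, OF _ Ps] unfolding prefixes_of_Infinite by auto
    ultimately show ?thesis using win[of "Infinite \<pi>"] wins_for_system.simps(1) by blast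
  qed
  ultimately show ?R by blast
next
  assume ?R
  then obtain g where g: "\<And>h. outcome G s (environment_moves G P g) h \<Longrightarrow>
          g h \<in> valid_inputs G (last h)"
    and inf: "\<And>\<pi>. \<forall>n. outcome G s (environment_moves G P g) (map \<pi> [0..<Suc n]) \<Longrightarrow> \<pi> \<notin> phi G"
    by blast
  define g' where "g' h = (if g h \<in> valid_inputs G (last h) then g h
    else SOME y. y \<in> valid_inputs G (last h))" for h
  have "environment_strategy G s g'"
    by (auto simp: environment_strategy_def g'_def intro: someI)
  moreover have "\<not> (wins_for_system G p \<and> (\<forall>h \<in> prefixes_of p. P h))"
    if p: "play_from G s p" "environment_consistent G g' p" for p
  proof
    assume w: "wins_for_system G p \<and> (\<forall>h \<in> prefixes_of p. P h)"
    \<comment> \<open>The assumed \<open>P\<close> at all prefixes supplies the second half of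
      \<open>environment_moves\<close>.\<close>
    have "outcome G s (environment_moves G P g') h" if "h \<in> prefixes_of p" for h
      using play_prefix_outcome[OF p(1) _ that] p(2) w by (auto simp: environment_consistent_def)
    moreover have "outcome G s (environment_moves G P g) h"
      if "outcome G s (environment_moves G P g') h" for h
      using that by (rule outcome_mono) (use g in \<open>auto simp: g'_def\<close>)
    ultimately have out: "outcome G s (environment_moves G P g) h" if "h \<in> prefixes_of p" for h
      using that by blast
    show False
    proof (cases p)
      case (Infinite \<pi>)
      have "outcome G s (environment_moves G P g) (map \<pi> [0..<Suc n])" for n
        by (rule out) (unfold Infinite prefixes_of_Infinite, blast)
      then show ?thesis using inf[of \<pi>] w Infinite by simp
    next
      case (Env_Deadlock k)
      have "k \<in> prefixes_of p"
        using p(1) Env_Deadlock by (auto simp: history_from_def intro!: exI[of _ "length k"])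
      then show ?thesis using g out p(1) Env_Deadlock by fastforce
    qed (use w in simp)
  qed
  ultimately show ?L by blast
qed


section \<open>Energy levels and the states of the reduction\<close>

lemma energy_cong:
  "(\<And>j. j \<le> i \<Longrightarrow> \<sigma> j = \<tau> j) \<Longrightarrow> energy G c c0 \<sigma> i = energy G c c0 \<tau> i"
  by (induction i) auto

lemma energy_level_singleton [simp]: "energy_level G c c0 [s] = int c0"
  by (simp add: energy_level_def)

text \<open>Turns the recursion on positions of a sequence into one on appending a state, the form
  used in the inductions over histories.\<close>

lemma energy_level_snoc:
  assumes "h \<noteq> []"
  shows "energy_level G c c0 (h @ [t]) =
    min (int c) (energy_level G c c0 h + the (weight G (last h, t)))"
proof -
  obtain n where n: "length h = Suc n" using assms by (cases h) auto
  have "energy G c c0 (\<lambda>i. (h @ [t]) ! i) n = energy G c c0 (\<lambda>i. h ! i) n"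
    by (rule energy_cong) (simp add: n nth_append)
  then show ?thesis using assms n by (simp add: energy_level_def nth_append last_conv_nth)
qed

section \<open>States and moves with encoded credits\<close>

lemma vimage_star_state [simp]: "Inl -` star_state s c1 = s"
  by (auto simp: star_state_def)

text \<open>The original state is recovered by projection, the credit from its binary
  digits.\<close>

lemma star_state_eq_iff [simp]: "star_state s c1 = star_state t c2 \<longleftrightarrow> s = t \<and> c1 = c2"
proof
  assume eq: "star_state s c1 = star_state t c2"
  then have "s = t" by (metis vimage_star_state)
  moreover have "bit c1 i \<longleftrightarrow> bit c2 i" for i
    using arg_cong[OF eq, of "\<lambda>A. Inr i \<in> A"] by (auto simp: star_state_def)
  ultimately show "s = t \<and> c1 = c2" by (simp add: bit_eq_iff)
qed simp

lemma star_state_Un: "star_state (x \<union> y) n = Inl ` x \<union> star_state y n"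
  by (auto simp: star_state_def)

text \<open>Without \<open>n \<le> c\<close> the encoding could have bits outside
  \<open>yDom c\<close>, which the intersection with the outputs would cut off.\<close>

lemma star_state_Int:
  "star_state t n \<inter> inputs (star G c) = Inl ` (t \<inter> inputs G)"
  "n \<le> c \<Longrightarrow> star_state t n \<inter> outputs (star G c) = star_state (t \<inter> outputs G) n"
  using bits_le_floor_log[of n c] by (auto simp: star_def star_state_def yDom_def)

text \<open>\<open>rho_e\<close> of the reduction reads only projections, so the options of the
  environment do not depend on the credit.\<close>

lemma valid_inputs_star:
  assumes "s \<subseteq> vars G" "n \<le> c"
  shows "valid_inputs (star G c) (star_state s n) = (`) Inl ` valid_inputs G s"
proof -
  have "x \<in> (`) Inl ` valid_inputs G s"
    if "x \<subseteq> Inl ` inputs G" "(s, Inl -` x) \<in> rho_e G" for x :: "('a + nat) set"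
  proof -
    have "x = Inl ` (Inl -` x)" using that(1) by auto
    moreover have "Inl -` x \<in> valid_inputs G s" using that by (auto simp: valid_inputs_def)
    ultimately show ?thesis by blast
  qed
  moreover have "Inl -` (Inl ` x :: ('a + nat) set) = x" for x by auto
  ultimately show ?thesis
    using star_state_vars[OF assms] by (auto simp: star_def valid_inputs_def)
qed

text \<open>The system may announce any credit up to both \<open>c\<close> and \<open>n\<close> plus
  the weight, so it may also discard energy. If that sum is negative for every \<open>y\<close>, no
  output is valid: running out of energy becomes a deadlock.\<close>

lemma valid_outputs_star:
  assumes G: "game_structure G" and "n \<le> c" "x \<subseteq> inputs G" "s \<subseteq> vars G"
  shows "valid_outputs (star G c) (star_state s n) (Inl ` x) =
    {star_state y m | y m. y \<in> valid_outputs G s x \<and> m \<le> c \<and>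
      int m \<le> int n + the (weight G (s, x \<union> y))}" (is "?L = ?R")
proof
  show "?R \<subseteq> ?L"
  proof
    fix z assume "z \<in> ?R"
    then obtain y m where z: "z = star_state y m" and y: "y \<in> valid_outputs G s x"
      and m: "m \<le> c" "int m \<le> int n + the (weight G (s, x \<union> y))" by blast
    have "z \<subseteq> outputs (star G c)"
      using y z bits_le_floor_log[OF m(1)]
      by (fastforce simp: star_def star_state_def yDom_def valid_outputs_def)
    moreover have "(star_state s n, Inl ` x \<union> z) \<in> rho_s (star G c)"
      using y m G assms by (auto simp: z star_state_Un[symmetric] star_def valid_outputs_def game_structure_def)
    ultimately show "z \<in> ?L" by (simp add: valid_outputs_def)
  qed
next
  show "?L \<subseteq> ?R"
  proof
    fix z assume "z \<in> ?L"
    then have sub: "z \<subseteq> Inl ` outputs G \<union> yDom c"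
      and "(star_state s n, Inl ` x \<union> z) \<in> rho_s (star G c)"
      by (auto simp: valid_outputs_def star_def)
    then obtain t m where t: "Inl ` x \<union> z = star_state t m" "(s, t) \<in> rho_s G"
      and m: "m \<le> c" "int m \<le> int n + the (weight G (s, t))"
      by (auto simp: star_def)
    define y where "y = Inl -` z"
    have "t = x \<union> y" using arg_cong[OF t(1), of "\<lambda>A. Inl -` A"] by (auto simp: y_def)
    moreover have "y \<subseteq> outputs G" using sub by (auto simp: y_def yDom_def)
    moreover have "z = star_state y m"
    proof -
      \<comment> \<open>The embedded input contains no new variable, so all credit bits lie in
        \<open>z\<close>.\<close>
      have "Inr i \<in> z \<longleftrightarrow> bit m i" for i
        using arg_cong[OF t(1), of "\<lambda>A. Inr i \<in> A"] by (auto simp: star_state_def)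
      moreover have "Inl v \<in> z \<longleftrightarrow> v \<in> y" for v by (simp add: y_def)
      ultimately have "a \<in> z \<longleftrightarrow> a \<in> star_state y m" for a
        by (cases a) (auto simp: star_state_def)
      then show ?thesis by blast
    qed
    ultimately show "z \<in> ?R" using t m by (auto simp: valid_outputs_def)
  qed
qed

lemma successor_vars: "game_structure G \<Longrightarrow> successor G s t \<Longrightarrow> t \<subseteq> vars G"
  by (auto simp: game_structure_def successor_def valid_outputs_def)

lemma successor_star:
  assumes "game_structure G" "s \<subseteq> vars G" "n \<le> c"
  shows "successor (star G c) (star_state s n) u \<longleftrightarrow>
    (\<exists>t m. u = star_state t m \<and> successor G s t \<and> m \<le> c \<and> int m \<le> int n + the (weight G (s, t)))"
    (is "?L \<longleftrightarrow> ?R")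
proof
  assume ?L
  then obtain x y where x: "x \<in> valid_inputs G s"
    and y: "y \<in> valid_outputs (star G c) (star_state s n) (Inl ` x)" and u: "u = Inl ` x \<union> y"
    by (auto simp: successor_def valid_inputs_star[OF assms(2,3)])
  have "x \<subseteq> inputs G" using x by (simp add: valid_inputs_def)
  from y[unfolded valid_outputs_star[OF assms(1,3) this assms(2)]] show ?R
    using x unfolding u successor_def by (auto simp flip: star_state_Un) blast
next
  assume ?R
  then obtain x y m where x: "x \<in> valid_inputs G s" and y: "y \<in> valid_outputs G s x"
    and u: "u = star_state (x \<union> y) m" and m: "m \<le> c" "int m \<le> int n + the (weight G (s, x \<union> y))"
    by (auto simp: successor_def)
  have "x \<subseteq> inputs G" using x by (simp add: valid_inputs_def)
  from valid_outputs_star[OF assms(1,3) this assms(2)]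
  have "star_state y m \<in> valid_outputs (star G c) (star_state s n) (Inl ` x)" using y m by auto
  then show ?L
    unfolding successor_def valid_inputs_star[OF assms(2,3)] u star_state_Un using x by blast
qed

text \<open>The descriptions of moves in the reduction concern states over \<open>vars G\<close>;
  this supplies that condition at every outcome.\<close>

lemma outcome_vars:
  assumes "game_structure G" "s \<subseteq> vars G" "outcome G s M h"
  shows "last h \<subseteq> vars G"
  using assms(3) by induction (use assms(2) successor_vars[OF assms(1)] in auto)


section \<open>Translating strategies\<close>

text \<open>A strategy of the reduction may look at the credits, which a history of the original game does
  not record, so they have to be rebuilt along the history.\<close>

definition lift_history :: "('b list \<Rightarrow> 'a \<Rightarrow> 'b) \<Rightarrow> 'b \<Rightarrow> 'a list \<Rightarrow> 'b list" where
  "lift_history N u h = foldl (\<lambda>k t. k @ [N k t]) [u] (tl h)"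

lemma lift_history_singleton [simp]: "lift_history N u [s] = [u]"
  by (simp add: lift_history_def)

lemma lift_history_snoc:
  "h \<noteq> [] \<Longrightarrow> lift_history N u (h @ [t]) = lift_history N u h @ [N (lift_history N u h) t]"
  by (simp add: lift_history_def)

text \<open>The lift of a prefix is a prefix of the lift. Hence the last states of the lifted
  prefixes form one infinite sequence, by which infinite plays are lifted.\<close>

lemma lift_history_map_upt:
  "lift_history N u (map \<pi> [0..<Suc n]) =
    map (\<lambda>i. last (lift_history N u (map \<pi> [0..<Suc i]))) [0..<Suc n]"
proof (induction n)
  case (Suc n)
  have "lift_history N u (map \<pi> [0..<Suc (Suc n)]) =
      lift_history N u (map \<pi> [0..<Suc n]) @ [last (lift_history N u (map \<pi> [0..<Suc (Suc n)]))]"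
    using lift_history_snoc[of "map \<pi> [0..<Suc n]" N u "\<pi> (Suc n)"] by simp
  from this[unfolded Suc] show ?case by simp
qed simp

lemma phi_star: "\<pi> \<in> phi (star G c) \<longleftrightarrow> (\<forall>i. \<pi> i \<subseteq> star_vars G c) \<and> (\<lambda>i. Inl -` \<pi> i) \<in> phi G"
  by (simp add: star_def)

context
  fixes G :: "'v weighted_game" and c c0 :: nat and s :: "'v set"
  assumes W: "weighted_game_structure G" and c0: "c0 \<le> c" and s: "s \<subseteq> vars G"
begin

private lemma G: "game_structure G"
  using W by (simp add: weighted_game_structure_def)

private lemmas S = game_structure_star[OF W, of c]

private abbreviation "E \<equiv> energy_level G c c0"

private abbreviation "proj \<equiv> map (\<lambda>u :: ('v + nat) set. Inl -` u)"

text \<open>The truncation at \<open>c\<close> keeps the levels below the largest credit, starting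
  from \<open>c0 \<le> c\<close>.\<close>

lemma energy_level_le: "outcome G s M h \<Longrightarrow> E h \<le> int c"
  by (induction rule: outcome.induct) (auto simp: c0 energy_level_snoc outcome_not_Nil)

lemma system_energy_outcomes:
  "system_wins_energy G c c0 s \<longleftrightarrow>
    (\<exists>f. (\<forall>h. outcome G s (system_moves G f) h \<longrightarrow>
          0 \<le> E h \<and> (\<forall>x \<in> valid_inputs G (last h). f h x \<in> valid_outputs G (last h) x)) \<and>
      (\<forall>\<pi>. (\<forall>n. outcome G s (system_moves G f) (map \<pi> [0..<Suc n])) \<longrightarrow> \<pi> \<in> phi G))"
  unfolding system_wins_energy_def wins_energy_objective_def
  by (rule system_wins_iff_outcomes[OF G])

text \<open>The reduction has no condition on energy levels, so \<open>P\<close> is constantly true;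
  energy is enforced by \<open>rho_s\<close> instead.\<close>

lemma system_star_outcomes:
  "system_wins (star G c) (star_state s c0) \<longleftrightarrow>
    (\<exists>f. (\<forall>h. outcome (star G c) (star_state s c0) (system_moves (star G c) f) h \<longrightarrow>
          (\<forall>x \<in> valid_inputs (star G c) (last h). f h x \<in> valid_outputs (star G c) (last h) x)) \<and>
      (\<forall>\<pi>. (\<forall>n. outcome (star G c) (star_state s c0) (system_moves (star G c) f) (map \<pi> [0..<Suc n])) \<longrightarrow>
        \<pi> \<in> phi (star G c)))"
  using system_wins_iff_outcomes[OF S, of "star_state s c0" "\<lambda>_. True"]
  by (simp add: system_wins_def del: upt_Suc)

lemma environment_energy_outcomes:
  "environment_wins_energy G c c0 s \<longleftrightarrow>
    (\<exists>g. (\<forall>h. outcome G s (environment_moves G (\<lambda>h. 0 \<le> E h) g) h \<longrightarrow>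
          g h \<in> valid_inputs G (last h)) \<and>
      (\<forall>\<pi>. (\<forall>n. outcome G s (environment_moves G (\<lambda>h. 0 \<le> E h) g) (map \<pi> [0..<Suc n])) \<longrightarrow>
        \<pi> \<notin> phi G))"
  unfolding environment_wins_energy_def wins_energy_objective_def
  by (rule environment_wins_iff_outcomes[OF G]) simp

lemma environment_star_outcomes:
  "environment_wins (star G c) (star_state s c0) \<longleftrightarrow>
    (\<exists>g. (\<forall>h. outcome (star G c) (star_state s c0) (\<lambda>h t. t \<inter> inputs (star G c) = g h) h \<longrightarrow>
          g h \<in> valid_inputs (star G c) (last h)) \<and>
      (\<forall>\<pi>. (\<forall>n. outcome (star G c) (star_state s c0) (\<lambda>h t. t \<inter> inputs (star G c) = g h) (map \<pi> [0..<Suc n])) \<longrightarrow>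
        \<pi> \<notin> phi (star G c)))"
  using environment_wins_iff_outcomes[OF S, of "\<lambda>_. True" "star_state s c0"]
  by (simp add: environment_wins_def del: upt_Suc)

text \<open>The strategy projects the history, answers as \<open>f\<close> does and announces the
  exact energy level as credit. This output is valid because winning keeps all levels non-negative,
  and the new level is at most the old one plus the weight.\<close>

lemma system_energy_imp_star:
  assumes "system_wins_energy G c c0 s"
  shows "system_wins (star G c) (star_state s c0)"
proof -
  from assms[unfolded system_energy_outcomes] obtain f where
    f: "\<And>h. outcome G s (system_moves G f) h \<Longrightarrow>
      0 \<le> E h \<and> (\<forall>x \<in> valid_inputs G (last h). f h x \<in> valid_outputs G (last h) x)"
    and inf: "\<And>\<pi>. \<forall>n. outcome G s (system_moves G f) (map \<pi> [0..<Suc n]) \<Longrightarrow> \<pi> \<in> phi G"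
    by blast
  \<comment> \<open>Levels of histories consistent with \<open>f\<close> are non-negative, so
    \<open>nat\<close> loses nothing there.\<close>
  define f' where "f' k x' = (let h = proj k; x = Inl -` x'; y = f h x in
    star_state y (nat (E (h @ [x \<union> y]))))" for k and x' :: "('v + nat) set"
  let ?O = "outcome (star G c) (star_state s c0) (system_moves (star G c) f')"
  have sim: "outcome G s (system_moves G f) (proj k) \<and>
      last k = star_state (last (proj k)) (nat (E (proj k)))" if "?O k" for k
    using that
  proof induction
    case init
    show ?case using outcome.init[of G s] by simp
  next
    case (step k u)
    let ?h = "proj k"
    have h: "outcome G s (system_moves G f) ?h"
      and last: "last k = star_state (last ?h) (nat (E ?h))" using step.IH by auto
    have "nat (E ?h) \<le> c" using energy_level_le[OF h] by simp
    from successor_star[OF G outcome_vars[OF G s h] this] step.hyps(2) obtain t m where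
      u: "u = star_state t m" and t: "successor G (last ?h) t" and m: "m \<le> c"
      unfolding last by blast
    \<comment> \<open>Consistency fixes the whole output, hence also the credit, as the one computed
      by \<open>f'\<close>.\<close>
    have "star_state (t \<inter> outputs G) m = f' k (Inl ` (t \<inter> inputs G))"
      using step.hyps(3) m by (simp add: u star_state_Int)
    moreover have "Inl -` (Inl ` (t \<inter> inputs G) :: ('v + nat) set) = t \<inter> inputs G" by auto
    ultimately have "t \<inter> outputs G = f ?h (t \<inter> inputs G)"
      and "m = nat (E (?h @ [(t \<inter> inputs G) \<union> (t \<inter> outputs G)]))"
      by (auto simp: f'_def Let_def)
    then show ?case
      using outcome.step[OF h t] successor_Int(3)[OF G t] by (simp add: u)
  qed
  have "f' k x' \<in> valid_outputs (star G c) (last k) x'"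
    if k: "?O k" and x': "x' \<in> valid_inputs (star G c) (last k)" for k x'
  proof -
    let ?h = "proj k"
    have h: "outcome G s (system_moves G f) ?h"
      and last: "last k = star_state (last ?h) (nat (E ?h))" using sim[OF k] by auto
    have V: "last ?h \<subseteq> vars G" using outcome_vars[OF G s h] .
    have n: "nat (E ?h) \<le> c" using energy_level_le[OF h] by simp
    obtain x where x: "x \<in> valid_inputs G (last ?h)" "x' = Inl ` x"
      using x' unfolding last valid_inputs_star[OF V n] by blast
    have y: "f ?h x \<in> valid_outputs G (last ?h) x" using f[OF h] x by blast
    let ?t = "x \<union> f ?h x"
    have "successor G (last ?h) ?t" using x y by (auto simp: successor_def)
    then have t: "outcome G s (system_moves G f) (?h @ [?t])"
      by (rule outcome.step[OF h]) (use valid_moves_Int[OF G x(1) y] in simp)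
    have "f' k x' = star_state (f ?h x) (nat (E (?h @ [?t])))"
      by (simp add: f'_def Let_def x(2) inj_vimage_image_eq)
    moreover have "nat (E (?h @ [?t])) \<le> c" using energy_level_le[OF t] by simp
    moreover have "int (nat (E (?h @ [?t]))) \<le> int (nat (E ?h)) + the (weight G (last ?h, ?t))"
      using f[OF t] f[OF h] energy_level_snoc[OF outcome_not_Nil[OF h], of G c c0 ?t] by simp
    moreover have "x \<subseteq> inputs G" using x(1) by (simp add: valid_inputs_def)
    ultimately show ?thesis
      unfolding last x(2) using valid_outputs_star[OF G n _ V] y by blast
  qed
  moreover have "\<pi> \<in> phi (star G c)" if \<pi>: "\<forall>n. ?O (map \<pi> [0..<Suc n])" for \<pi>
  proof -
    have "(\<lambda>i. Inl -` \<pi> i) \<in> phi G"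
      using sim[OF \<pi>[rule_format]] by (intro inf) (simp add: comp_def del: upt_Suc)
    moreover have "\<pi> i \<subseteq> star_vars G c" for i
      using outcome_vars[OF S _ \<pi>[rule_format, of i]] star_state_vars[OF s c0] by (simp add: star_def)
    ultimately show ?thesis by (simp add: phi_star)
  qed
  ultimately show ?thesis unfolding system_star_outcomes by blast
qed

text \<open>The credits announced by \<open>f'\<close> are rebuilt along the history and bound the
  energy level from below: a new credit is at most \<open>c\<close> and at most the old one plus the
  weight, so the bound survives each step and its truncation. Credits being natural numbers, no
  level becomes negative.\<close>

lemma system_star_imp_energy:
  assumes "system_wins (star G c) (star_state s c0)"
  shows "system_wins_energy G c c0 s"
proof -
  from assms[unfolded system_star_outcomes] obtain f' where
    f': "\<And>k x. outcome (star G c) (star_state s c0) (system_moves (star G c) f') k \<Longrightarrow>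
      x \<in> valid_inputs (star G c) (last k) \<Longrightarrow> f' k x \<in> valid_outputs (star G c) (last k) x"
    and inf: "\<And>\<pi>. \<forall>n. outcome (star G c) (star_state s c0) (system_moves (star G c) f') (map \<pi> [0..<Suc n]) \<Longrightarrow>
      \<pi> \<in> phi (star G c)"
    by blast
  let ?O = "outcome (star G c) (star_state s c0) (system_moves (star G c) f')"
  \<comment> \<open>Only the input part of each state is read; the outputs and the credit are taken
    from \<open>f'\<close>. At histories consistent with \<open>f\<close> these outputs are those of
    the state itself.\<close>
  define L where "L = lift_history
    (\<lambda>k t. Inl ` (t \<inter> inputs G) \<union> f' k (Inl ` (t \<inter> inputs G))) (star_state s c0)"
  define f where "f h x = Inl -` f' (L h) (Inl ` x)" for h x
  have reply: "\<exists>m. f' (L h) (Inl ` x) = star_state (f h x) m \<and> f h x \<in> valid_outputs G (last h) x \<and>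
      m \<le> c \<and> int m \<le> int n + the (weight G (last h, x \<union> f h x))"
    if O: "?O (L h)" "last (L h) = star_state (last h) n" and n: "n \<le> c" and V: "last h \<subseteq> vars G"
      and x: "x \<in> valid_inputs G (last h)" for h n x
  proof -
    have "f' (L h) (Inl ` x) \<in> valid_outputs (star G c) (star_state (last h) n) (Inl ` x)"
      using f'[OF O(1), of "Inl ` x"] x unfolding O(2) valid_inputs_star[OF V n] by blast
    moreover have "x \<subseteq> inputs G" using x by (simp add: valid_inputs_def)
    ultimately obtain y m where "f' (L h) (Inl ` x) = star_state y m"
      "y \<in> valid_outputs G (last h) x" "m \<le> c" "int m \<le> int n + the (weight G (last h, x \<union> y))"
      using valid_outputs_star[OF G n _ V] by auto
    then show ?thesis by (auto simp: f_def)
  qed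
  have sim: "?O (L h) \<and> (\<exists>n \<le> c. last (L h) = star_state (last h) n \<and> int n \<le> E h)"
    if "outcome G s (system_moves G f) h" for h
    using that
  proof induction
    case init
    show ?case using outcome.init[of "star G c" "star_state s c0"] c0 by (auto simp: L_def)
  next
    case (step h t)
    then obtain n where n: "?O (L h)" "last (L h) = star_state (last h) n" "n \<le> c" "int n \<le> E h"
      by blast
    have V: "last h \<subseteq> vars G" using outcome_vars[OF G s step.hyps(1)] .
    have h: "h \<noteq> []" using outcome_not_Nil[OF step.hyps(1)] .
    let ?x = "t \<inter> inputs G"
    note t = successor_Int[OF G step.hyps(2)]
    obtain m where m: "f' (L h) (Inl ` ?x) = star_state (t \<inter> outputs G) m" "m \<le> c"
      "int m \<le> int n + the (weight G (last h, t))"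
      using reply[OF n(1-3) V t(1)] step.hyps(3) t(3) by auto
    have L: "L (h @ [t]) = L h @ [star_state t m]"
      using m(1) t(3) unfolding L_def lift_history_snoc[OF h] by (metis star_state_Un)
    have "successor (star G c) (last (L h)) (star_state t m)"
      unfolding n(2) using successor_star[OF G V n(3)] step.hyps(2) m by blast
    then have "?O (L (h @ [t]))"
      unfolding L by (rule outcome.step[OF n(1)]) (use m in \<open>simp add: star_state_Int\<close>)
    moreover have "int m \<le> E (h @ [t])" using m n(4) by (simp add: energy_level_snoc[OF h])
    ultimately show ?case using m(2) by (auto simp: L)
  qed
  have "0 \<le> E h \<and> (\<forall>x \<in> valid_inputs G (last h). f h x \<in> valid_outputs G (last h) x)"
    if h: "outcome G s (system_moves G f) h" for h
    using sim[OF h] reply[of h] outcome_vars[OF G s h] by fastforce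
  moreover have "\<pi> \<in> phi G"
    if \<pi>: "\<forall>n. outcome G s (system_moves G f) (map \<pi> [0..<Suc n])" for \<pi>
  proof -
    \<comment> \<open>The lift of the infinite play: the \<open>i\<close>-th lifted prefix ends with
      the state that projects to \<open>\<pi> i\<close>.\<close>
    define \<pi>' where "\<pi>' i = last (L (map \<pi> [0..<Suc i]))" for i
    have L: "L (map \<pi> [0..<Suc n]) = map \<pi>' [0..<Suc n]" for n
      unfolding L_def \<pi>'_def by (rule lift_history_map_upt)
    have "\<forall>n. ?O (map \<pi>' [0..<Suc n])"
      unfolding L[symmetric] using sim[OF \<pi>[rule_format]] by blast
    then have "\<pi>' \<in> phi (star G c)" by (rule inf)
    moreover have "\<exists>n. \<pi>' i = star_state (\<pi> i) n" for i
      using sim[OF \<pi>[rule_format, of i]] by (auto simp: \<pi>'_def)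
    then have "Inl -` \<pi>' i = \<pi> i" for i by (metis vimage_star_state)
    ultimately show ?thesis by (simp add: phi_star)
  qed
  ultimately show ?thesis unfolding system_energy_outcomes by blast
qed

text \<open>The environment plays \<open>g\<close> on projections. Whatever credits the system
  announces, they are at most the energy level, so projected histories keep non-negative energy and
  \<open>g\<close> still has to win from them.\<close>

lemma environment_energy_imp_star:
  assumes "environment_wins_energy G c c0 s"
  shows "environment_wins (star G c) (star_state s c0)"
proof -
  from assms[unfolded environment_energy_outcomes] obtain g where
    g: "\<And>h. outcome G s (environment_moves G (\<lambda>h. 0 \<le> E h) g) h \<Longrightarrow> g h \<in> valid_inputs G (last h)"
    and inf: "\<And>\<pi>. \<forall>n. outcome G s (environment_moves G (\<lambda>h. 0 \<le> E h) g) (map \<pi> [0..<Suc n]) \<Longrightarrow>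
      \<pi> \<notin> phi G"
    by blast
  define g' :: "('v + nat) set list \<Rightarrow> ('v + nat) set" where "g' k = Inl ` g (proj k)" for k
  let ?O = "outcome (star G c) (star_state s c0) (\<lambda>k u. u \<inter> inputs (star G c) = g' k)"
  have sim: "outcome G s (environment_moves G (\<lambda>h. 0 \<le> E h) g) (proj k) \<and>
      (\<exists>n \<le> c. last k = star_state (last (proj k)) n \<and> int n \<le> E (proj k))" if "?O k" for k
    using that
  proof induction
    case init
    show ?case using outcome.init[of G s] c0 by auto
  next
    case (step k u)
    let ?h = "proj k"
    obtain n where h: "outcome G s (environment_moves G (\<lambda>h. 0 \<le> E h) g) ?h"
      and n: "last k = star_state (last ?h) n" "n \<le> c" "int n \<le> E ?h" using step.IH by blast
    from successor_star[OF G outcome_vars[OF G s h] n(2)] step.hyps(2) obtain t m where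
      u: "u = star_state t m" and t: "successor G (last ?h) t"
      and m: "m \<le> c" "int m \<le> int n + the (weight G (last ?h, t))"
      unfolding n(1) by blast
    have "t \<inter> inputs G = g ?h"
      using step.hyps(3) by (simp add: u star_state_Int g'_def inj_image_eq_iff)
    \<comment> \<open>As \<open>int m\<close> is non-negative, this also gives the safety half of
      \<open>environment_moves\<close>.\<close>
    moreover have E: "int m \<le> E (?h @ [t])"
      using m n(3) by (simp add: energy_level_snoc[OF outcome_not_Nil[OF h]])
    ultimately show ?case
      using outcome.step[OF h t] m(1) by (auto simp: u)
  qed
  have "g' k \<in> valid_inputs (star G c) (last k)" if k: "?O k" for k
  proof -
    obtain n where h: "outcome G s (environment_moves G (\<lambda>h. 0 \<le> E h) g) (proj k)"
      and n: "last k = star_state (last (proj k)) n" "n \<le> c" using sim[OF k] by blast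
    show ?thesis
      unfolding n(1) valid_inputs_star[OF outcome_vars[OF G s h] n(2)] g'_def using g[OF h] by blast
  qed
  moreover have "\<pi> \<notin> phi (star G c)" if \<pi>: "\<forall>n. ?O (map \<pi> [0..<Suc n])" for \<pi>
  proof -
    have "(\<lambda>i. Inl -` \<pi> i) \<notin> phi G"
      using sim[OF \<pi>[rule_format]] by (intro inf) (simp add: comp_def del: upt_Suc)
    then show ?thesis by (simp add: phi_star)
  qed
  ultimately show ?thesis unfolding environment_star_outcomes by blast
qed

text \<open>\<open>g'\<close> is confronted with a system that never discards energy voluntarily:
  lifted histories carry the exact levels as credits. While levels stay non-negative, each move of
  the original game lifts to a move of the reduction; after that the environment has already
  won.\<close>

lemma environment_star_imp_energy:
  assumes "environment_wins (star G c) (star_state s c0)"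
  shows "environment_wins_energy G c c0 s"
proof -
  from assms[unfolded environment_star_outcomes] obtain g' where
    g': "\<And>k. outcome (star G c) (star_state s c0) (\<lambda>k u. u \<inter> inputs (star G c) = g' k) k \<Longrightarrow>
      g' k \<in> valid_inputs (star G c) (last k)"
    and inf: "\<And>\<pi>. \<forall>n. outcome (star G c) (star_state s c0) (\<lambda>k u. u \<inter> inputs (star G c) = g' k)
      (map \<pi> [0..<Suc n]) \<Longrightarrow> \<pi> \<notin> phi (star G c)"
    by blast
  let ?O = "outcome (star G c) (star_state s c0) (\<lambda>k u. u \<inter> inputs (star G c) = g' k)"
  \<comment> \<open>The step function sees only the lifted history, so the level is computed on its
    projection; that this is the original history is part of the invariant
    \<open>sim\<close>.\<close>
  define L where "L = lift_history (\<lambda>k t. star_state t (nat (E (proj k @ [t])))) (star_state s c0)"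
  define g where "g h = Inl -` g' (L h)" for h
  have reply: "g' (L h) = Inl ` g h \<and> g h \<in> valid_inputs G (last h)"
    if "?O (L h)" "last (L h) = star_state (last h) n" "n \<le> c" "last h \<subseteq> vars G" for h n
    using g'[OF that(1)] unfolding that(2) valid_inputs_star[OF that(4,3)]
    by (auto simp: g_def inj_vimage_image_eq)
  have safe: "0 \<le> E h" "E h \<le> int c" if "outcome G s (environment_moves G (\<lambda>h. 0 \<le> E h) g) h" for h
    using outcome_environment_safe[where P = "\<lambda>h. 0 \<le> E h", OF that] energy_level_le[OF that]
    by simp_all
  have sim: "?O (L h) \<and> proj (L h) = h \<and> last (L h) = star_state (last h) (nat (E h))"
    if "outcome G s (environment_moves G (\<lambda>h. 0 \<le> E h) g) h" for h
    using that
  proof induction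
    case init
    show ?case using outcome.init[of "star G c" "star_state s c0"] by (auto simp: L_def)
  next
    case (step h t)
    have n: "?O (L h)" "last (L h) = star_state (last h) (nat (E h))" "nat (E h) \<le> c"
      and proj: "proj (L h) = h"
      using step.IH safe[OF step.hyps(1)] by auto
    have V: "last h \<subseteq> vars G" using outcome_vars[OF G s step.hyps(1)] .
    have h: "h \<noteq> []" using outcome_not_Nil[OF step.hyps(1)] .
    let ?m = "nat (E (h @ [t]))"
    have L: "L (h @ [t]) = L h @ [star_state t ?m]"
      using proj unfolding L_def lift_history_snoc[OF h] by simp
    \<comment> \<open>The move keeps the energy non-negative, so the credit is the truncated sum
      itself and not a value cut off at 0 by \<open>nat\<close>.\<close>
    have "?m \<le> c" "int ?m \<le> int (nat (E h)) + the (weight G (last h, t))"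
      using step.hyps(3) safe[OF step.hyps(1)] by (auto simp: energy_level_snoc[OF h])
    then have "successor (star G c) (last (L h)) (star_state t ?m)"
      unfolding n(2) using successor_star[OF G V n(3)] step.hyps(2) by blast
    moreover have "star_state t ?m \<inter> inputs (star G c) = g' (L h)"
      using reply[OF n V] step.hyps(3) by (simp add: star_state_Int)
    ultimately have "?O (L (h @ [t]))"
      unfolding L by (rule outcome.step[OF n(1)])
    then show ?case using proj by (simp add: L)
  qed
  have "g h \<in> valid_inputs G (last h)"
    if h: "outcome G s (environment_moves G (\<lambda>h. 0 \<le> E h) g) h" for h
    using sim[OF h] reply[of h "nat (E h)"] outcome_vars[OF G s h] safe[OF h] by simp
  moreover have "\<pi> \<notin> phi G"
    if \<pi>: "\<forall>n. outcome G s (environment_moves G (\<lambda>h. 0 \<le> E h) g) (map \<pi> [0..<Suc n])" for \<pi>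
  proof -
    define \<pi>' where "\<pi>' i = last (L (map \<pi> [0..<Suc i]))" for i
    have L: "L (map \<pi> [0..<Suc n]) = map \<pi>' [0..<Suc n]" for n
      unfolding L_def \<pi>'_def by (rule lift_history_map_upt)
    have O: "\<forall>n. ?O (map \<pi>' [0..<Suc n])"
      unfolding L[symmetric] using sim[OF \<pi>[rule_format]] by blast
    then have "\<pi>' i \<subseteq> star_vars G c" for i
      using outcome_vars[OF S _ O[rule_format, of i]] star_state_vars[OF s c0] by (simp add: star_def)
    moreover have "\<exists>n. \<pi>' i = star_state (\<pi> i) n" for i
      using sim[OF \<pi>[rule_format, of i]] by (auto simp: \<pi>'_def)
    then have "Inl -` \<pi>' i = \<pi> i" for i by (metis vimage_star_state)
    ultimately show ?thesis using inf[OF O] by (simp add: phi_star)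
  qed
  ultimately show ?thesis unfolding environment_energy_outcomes by blast
qed

end

theorem theorem3p9:
  fixes G :: "'v weighted_game" and c c0 :: nat and s :: "'v set"
  assumes "weighted_game_structure G"
    and "c0 \<le> c"
    and "s \<subseteq> vars G"
  shows "(system_wins_energy G c c0 s \<longleftrightarrow> system_wins (star G c) (star_state s c0)) \<and>
    (environment_wins_energy G c c0 s \<longleftrightarrow> environment_wins (star G c) (star_state s c0))"
  using system_energy_imp_star[OF assms] system_star_imp_energy[OF assms]
    environment_energy_imp_star[OF assms] environment_star_imp_energy[OF assms] by blast

end
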